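(* There exists a $2$-dimensional, complete, irreducible, one-to-one immersed submanifold $M=f(\mathbb{R}^2)$ of the hyperbolic space $\mathbb{H}^{3}$ with constant index of nullity $1$ (so that the distribution $\mathcal{N}^{\perp}$ perpendicular to the nullity distribution $\mathcal{N}$ is $1$-dimensional and hence integrable). In particular, it is not true for $M$ that any two of its points can be joined by a curve in $M$ everywhere perpendicular to $\mathcal{N}$.
   Context: $\mathbb{H}^3$ is the connected component through $e_4=(0,0,0,1)$ of $\{x\in\mathbb{L}^4:\langle x,x\rangle=-1\}$, where $\mathbb{L}^4$ is $\mathbb{R}^4$ with the Lorentz metric $\langle x,y\rangle=x_1y_1+x_2y_2+x_3y_3-x_4y_4$. For an immersed submanifold $M$ of $\mathbb{H}^3$ with second fundamental form $\alpha$ (in $\mathbb{H}^3$), the nullity subspace at $p$ is $\mathcal{N}_p=\{x\in T_pM:\alpha(x,\cdot)\equiv0\}$ and the index of nullity at $p$ is $\dim\mathcal{N}_p$. $\mathcal{N}^\perp$ is the orthogonal complement of $\mathcal{N}$ in $TM$. Complete means complete in the induced Riemannian metric. $M\subset\mathbb{H}^3$ is irreducible if, as a submanifold of $\mathbb{L}^4$, it admits no non-trivial distribution $\mathcal{D}$ that is invariant under all shape operators of $M$ and such that both $\mathcal{D}$ and $\mathcal{D}^\perp$ (orthogonal complement in $TM$) are autoparallel (i.e. $M$ is not, locally, an extrinsic product in $\mathbb{L}^4$). Curves are piecewise differentiable. *)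

theory Defs
  imports "HOL-Analysis.Analysis"
begin

section \<open>Hyperbolic space in Lorentz space\<close>

definition lor :: "real^4 \<Rightarrow> real^4 \<Rightarrow> real" where
  "lor x y = x$1 * y$1 + x$2 * y$2 + x$3 * y$3 - x$4 * y$4"

definition hyp3 :: "(real^4) set" where
  "hyp3 = connected_component_set {x. lor x x = - 1} (axis 4 1)"

definition tangent_hyp3 :: "real^4 \<Rightarrow> (real^4) set" where
  "tangent_hyp3 q = {v. lor v q = 0}"

text \<open>Lorentz-orthogonal projection. It is well defined for subspaces on which the form is
  nondegenerate, in particular for the tangent spaces of \<open>hyp3\<close> and of submanifolds of it.\<close>

definition lor_proj :: "(real^4) set \<Rightarrow> real^4 \<Rightarrow> real^4" where
  "lor_proj W v = (THE w. w \<in> W \<and> (\<forall>u\<in>W. lor (v - w) u = 0))"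

section \<open>Smooth maps and immersions\<close>

primrec Ck_on :: "nat \<Rightarrow> 'a::euclidean_space set \<Rightarrow> ('a \<Rightarrow> 'b::real_normed_vector) \<Rightarrow> bool" where
  "Ck_on 0 U f \<longleftrightarrow> continuous_on U f"
| "Ck_on (Suc k) U f \<longleftrightarrow> (\<forall>x\<in>U. f differentiable (at x)) \<and>
     (\<forall>v. Ck_on k U (\<lambda>x. frechet_derivative f (at x) v))"

text \<open>To be used for open \<open>U\<close> only.\<close>

definition smooth_on :: "'a::euclidean_space set \<Rightarrow> ('a \<Rightarrow> 'b::real_normed_vector) \<Rightarrow> bool" where
  "smooth_on U f \<longleftrightarrow> (\<forall>k. Ck_on k U f)"

abbreviation dff :: "('a::euclidean_space \<Rightarrow> 'b::real_normed_vector) \<Rightarrow> 'a \<Rightarrow> 'a \<Rightarrow> 'b" where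
  "dff f p \<equiv> frechet_derivative f (at p)"

definition immersion :: "('a::euclidean_space \<Rightarrow> real^4) \<Rightarrow> bool" where
  "immersion f \<longleftrightarrow> smooth_on UNIV f \<and> (\<forall>p. inj (dff f p))"

text \<open>
  A one-to-one immersed submanifold \<open>M = range f\<close> carries the manifold structure for which
  \<open>f\<close> is a diffeomorphism onto \<open>M\<close>. Points, tangent vectors, vector fields, distributions
  and curves of \<open>M\<close> are therefore given by their pullbacks along \<open>f\<close> to the parameter space.
\<close>

definition tangent :: "('a::euclidean_space \<Rightarrow> real^4) \<Rightarrow> 'a \<Rightarrow> (real^4) set" where
  "tangent f p = range (dff f p)"

definition normal_L4 :: "('a::euclidean_space \<Rightarrow> real^4) \<Rightarrow> 'a \<Rightarrow> (real^4) set" where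
  "normal_L4 f p = {\<xi>. \<forall>v\<in>tangent f p. lor \<xi> v = 0}"

definition metric :: "('a::euclidean_space \<Rightarrow> real^4) \<Rightarrow> 'a \<Rightarrow> 'a \<Rightarrow> 'a \<Rightarrow> real" where
  "metric f p x y = lor (dff f p x) (dff f p y)"

definition perp :: "('a::euclidean_space \<Rightarrow> real^4) \<Rightarrow> ('a \<Rightarrow> 'a set) \<Rightarrow> 'a \<Rightarrow> 'a set" where
  "perp f D p = {x. \<forall>y\<in>D p. metric f p x y = 0}"

section \<open>Completeness of the induced metric\<close>

text \<open>
  \<open>piecewise_C1_differentiable_on\<close> does not bound the velocity near the exceptional points.
  Requiring the speed to be integrable excludes curves of infinite length, whose
  \<open>integral\<close> would be \<open>0\<close> by convention.
\<close>

definition riem_dist :: "('a::euclidean_space \<Rightarrow> real^4) \<Rightarrow> 'a \<Rightarrow> 'a \<Rightarrow> real" where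
  "riem_dist f p q = Inf {L. \<exists>c :: real \<Rightarrow> 'a.
     c piecewise_C1_differentiable_on {0..1} \<and> c 0 = p \<and> c 1 = q \<and>
     ((\<lambda>t. sqrt (metric f (c t) (vector_derivative c (at t)) (vector_derivative c (at t))))
        has_integral L) {0..1}}"

definition riem_complete :: "('a::euclidean_space \<Rightarrow> real^4) \<Rightarrow> bool" where
  "riem_complete f \<longleftrightarrow>
     (\<forall>s :: nat \<Rightarrow> 'a. (\<forall>e>0. \<exists>N. \<forall>m\<ge>N. \<forall>n\<ge>N. riem_dist f (s m) (s n) < e) \<longrightarrow>
        (\<exists>l. (\<lambda>n. riem_dist f (s n) l) \<longlonglongrightarrow> 0))"

section \<open>Second fundamental forms, shape operators, nullity\<close>

text \<open>The flat derivative in direction \<open>x\<close> of the tangent field along \<open>f\<close> given by \<open>Y\<close>.\<close>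

definition ambient_deriv ::
    "('a::euclidean_space \<Rightarrow> real^4) \<Rightarrow> 'a \<Rightarrow> 'a \<Rightarrow> ('a \<Rightarrow> 'a) \<Rightarrow> real^4" where
  "ambient_deriv f p x Y = dff (\<lambda>q. dff f q (Y q)) p x"

definition levi_civita ::
    "('a::euclidean_space \<Rightarrow> real^4) \<Rightarrow> 'a \<Rightarrow> 'a \<Rightarrow> ('a \<Rightarrow> 'a) \<Rightarrow> 'a" where
  "levi_civita f p x Y = (THE z. dff f p z = lor_proj (tangent f p) (ambient_deriv f p x Y))"

text \<open>
  Both second fundamental forms are tensorial, so the second argument may be extended to a
  constant field. The Levi-Civita connection of \<open>hyp3\<close> is the projection of the flat
  derivative to the tangent space of \<open>hyp3\<close>.
\<close>

definition sff_H3 :: "('a::euclidean_space \<Rightarrow> real^4) \<Rightarrow> 'a \<Rightarrow> 'a \<Rightarrow> 'a \<Rightarrow> real^4" where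
  "sff_H3 f p x y =
     (let w = lor_proj (tangent_hyp3 (f p)) (ambient_deriv f p x (\<lambda>_. y))
      in w - lor_proj (tangent f p) w)"

definition sff_L4 :: "('a::euclidean_space \<Rightarrow> real^4) \<Rightarrow> 'a \<Rightarrow> 'a \<Rightarrow> 'a \<Rightarrow> real^4" where
  "sff_L4 f p x y =
     (let w = ambient_deriv f p x (\<lambda>_. y) in w - lor_proj (tangent f p) w)"

definition shape :: "('a::euclidean_space \<Rightarrow> real^4) \<Rightarrow> 'a \<Rightarrow> real^4 \<Rightarrow> 'a \<Rightarrow> 'a" where
  "shape f p \<xi> x = (THE z. \<forall>y. metric f p z y = lor (sff_L4 f p x y) \<xi>)"

definition nullity :: "('a::euclidean_space \<Rightarrow> real^4) \<Rightarrow> 'a \<Rightarrow> 'a set" where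
  "nullity f p = {x. \<forall>y. sff_H3 f p x y = 0}"

definition nullity_perp :: "('a::euclidean_space \<Rightarrow> real^4) \<Rightarrow> 'a \<Rightarrow> 'a set" where
  "nullity_perp f = perp f (nullity f)"

section \<open>Distributions and irreducibility\<close>

definition distribution :: "nat \<Rightarrow> ('a::euclidean_space \<Rightarrow> 'a set) \<Rightarrow> bool" where
  "distribution k D \<longleftrightarrow> (\<forall>p. \<exists>U (X :: nat \<Rightarrow> 'a \<Rightarrow> 'a). open U \<and> p \<in> U \<and>
     (\<forall>i<k. smooth_on U (X i)) \<and>
     (\<forall>q\<in>U. D q = span ((\<lambda>i. X i q) ` {..<k}) \<and> dim (D q) = k))"

text \<open>Integrability is stated by charts \<open>h\<close> in which the distribution is constant, that is,
  by foliation charts.\<close>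

definition integrable_distribution :: "('a::euclidean_space \<Rightarrow> 'a set) \<Rightarrow> bool" where
  "integrable_distribution D \<longleftrightarrow> (\<forall>p. \<exists>U (h :: 'a \<Rightarrow> 'a) W. open U \<and> p \<in> U \<and>
     smooth_on U h \<and> inj_on h U \<and> subspace W \<and>
     (\<forall>q\<in>U. bij (dff h q) \<and> D q = {x. dff h q x \<in> W}))"

definition autoparallel :: "('a::euclidean_space \<Rightarrow> real^4) \<Rightarrow> ('a \<Rightarrow> 'a set) \<Rightarrow> bool" where
  "autoparallel f D \<longleftrightarrow>
     (\<forall>U Y. open U \<longrightarrow> smooth_on U Y \<longrightarrow> (\<forall>q\<in>U. Y q \<in> D q) \<longrightarrow>
        (\<forall>p\<in>U. \<forall>x\<in>D p. levi_civita f p x Y \<in> D p))"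

definition shape_invariant :: "('a::euclidean_space \<Rightarrow> real^4) \<Rightarrow> ('a \<Rightarrow> 'a set) \<Rightarrow> bool" where
  "shape_invariant f D \<longleftrightarrow> (\<forall>p. \<forall>\<xi>\<in>normal_L4 f p. \<forall>x\<in>D p. shape f p \<xi> x \<in> D p)"

definition irreducible_submanifold :: "('a::euclidean_space \<Rightarrow> real^4) \<Rightarrow> bool" where
  "irreducible_submanifold f \<longleftrightarrow>
     \<not> (\<exists>k D. 0 < k \<and> k < DIM('a) \<and> distribution k D \<and> shape_invariant f D \<and>
            autoparallel f D \<and> autoparallel f (perp f D))"

section \<open>Curves perpendicular to the nullity distribution\<close>

definition perp_joinable :: "('a::euclidean_space \<Rightarrow> real^4) \<Rightarrow> 'a \<Rightarrow> 'a \<Rightarrow> bool" where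
  "perp_joinable f p q \<longleftrightarrow> (\<exists>c :: real \<Rightarrow> 'a.
     c piecewise_differentiable_on {0..1} \<and> c 0 = p \<and> c 1 = q \<and>
     (\<forall>t\<in>{0..1}. \<forall>v. (c has_vector_derivative v) (at t within {0..1}) \<longrightarrow>
        v \<in> nullity_perp f (c t)))"

end

theory Submission
  imports Defs
begin

text \<open>
  The surface is the cylinder over a horocycle: through each point of a horocycle \<open>\<gamma>\<close> of a totally
  geodesic hyperbolic plane one takes the geodesic of the hyperbolic space perpendicular to that
  plane, \<open>f(s,t) = cosh t \<gamma>(s) + sinh t e\<^sub>3\<close>. The induced metric is \<open>cosh\<^sup>2 t ds\<^sup>2 + dt\<^sup>2\<close>, which dominates
  the Euclidean one and is therefore complete. As \<open>\<gamma>\<close> has curvature 1, the nullity is spanned by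
  \<open>\<partial>\<^sub>t\<close>, so curves perpendicular to it keep \<open>t\<close> constant. A distribution invariant under the shape
  operators is the span of \<open>\<partial>\<^sub>s\<close> or of \<open>\<partial>\<^sub>t\<close>, and the curves \<open>t = const \<noteq> 0\<close> are not geodesics.
\<close>

section \<open>Lorentz form and projections\<close>

lemma lor_algebra:
  "lor (x + y) z = lor x z + lor y z" "lor (x - y) z = lor x z - lor y z"
  "lor (c *\<^sub>R x) z = c * lor x z" "lor z (x + y) = lor z x + lor z y"
  "lor z (x - y) = lor z x - lor z y" "lor z (c *\<^sub>R x) = c * lor z x"
  "lor 0 z = 0" "lor z 0 = 0" "lor (- x) z = - lor x z"
  by (simp_all add: lor_def algebra_simps)

lemma lor_commute: "lor x y = lor y x"
  by (simp add: lor_def mult.commute)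

lemma lor_nondegenerate:
  assumes "\<And>u. lor w u = 0"
  shows "w = 0"
  using assms[of "axis 1 1"] assms[of "axis 2 1"] assms[of "axis 3 1"] assms[of "axis 4 1"]
  by (simp add: lor_def axis_def vec_eq_iff forall_4)

text \<open>Two candidates for the \<open>THE\<close> in \<open>lor_proj\<close> differ by an
  element of \<open>W\<close> orthogonal to all of \<open>W\<close>, so nondegeneracy of the form on
  \<open>W\<close> gives uniqueness.\<close>

lemma lor_proj_eqI:
  assumes "subspace W" "w \<in> W" "\<And>u. u \<in> W \<Longrightarrow> lor (v - w) u = 0"
    and nondeg: "\<And>z. z \<in> W \<Longrightarrow> (\<And>u. u \<in> W \<Longrightarrow> lor z u = 0) \<Longrightarrow> z = 0"
  shows "lor_proj W v = w"
  unfolding lor_proj_def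
proof (rule the_equality)
  fix w' assume w': "w' \<in> W \<and> (\<forall>u\<in>W. lor (v - w') u = 0)"
  have "w' - w = 0"
  proof (rule nondeg)
    show "w' - w \<in> W"
      using w' assms(1,2) by (simp add: subspace_diff)
    show "lor (w' - w) u = 0" if "u \<in> W" for u
      using w' assms(3)[OF that] that by (auto simp: lor_algebra)
  qed
  then show "w' = w" by simp
qed (use assms in auto)

text \<open>The sign is plus because \<open>q\<close> is timelike. Any \<open>u\<close> becomes
  tangent after adding a multiple of \<open>q\<close>, to which tangent vectors are orthogonal, so
  nondegeneracy on the tangent space follows from that on the whole space.\<close>

lemma lor_proj_tangent_hyp3:
  assumes q: "lor q q = - 1"
  shows "lor_proj (tangent_hyp3 q) v = v + lor v q *\<^sub>R q"
proof (rule lor_proj_eqI)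
  show "subspace (tangent_hyp3 q)"
    by (auto simp: subspace_def tangent_hyp3_def lor_algebra)
  show "v + lor v q *\<^sub>R q \<in> tangent_hyp3 q"
    by (simp add: tangent_hyp3_def lor_algebra q)
  show "lor (v - (v + lor v q *\<^sub>R q)) u = 0" if "u \<in> tangent_hyp3 q" for u
    using that lor_commute[of q u] by (simp add: tangent_hyp3_def lor_algebra)
  show "z = 0" if z: "z \<in> tangent_hyp3 q" and orth: "\<And>u. u \<in> tangent_hyp3 q \<Longrightarrow> lor z u = 0" for z
  proof (rule lor_nondegenerate)
    fix u
    have "lor z (u + lor u q *\<^sub>R q) = 0"
      by (rule orth) (simp add: tangent_hyp3_def lor_algebra q)
    then show "lor z u = 0"
      using z by (simp add: tangent_hyp3_def lor_algebra)
  qed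
qed

section \<open>Smoothness\<close>

text \<open>The induction on \<open>k\<close> runs over the whole family, since a derivative leaves
  the single map but not \<open>S\<close>.\<close>

lemma Ck_on_UNIV_if_closed_under_derivatives:
  assumes "\<And>f x. f \<in> S \<Longrightarrow> f differentiable (at x)"
    and "\<And>f v. f \<in> S \<Longrightarrow> (\<lambda>x. dff f x v) \<in> S"
  shows "f \<in> S \<Longrightarrow> Ck_on k UNIV f"
proof (induction k arbitrary: f)
  case 0
  then show ?case
    using assms(1) by (auto intro!: continuous_at_imp_continuous_on differentiable_imp_continuous_within)
next
  case (Suc k)
  then show ?case using assms by auto
qed

lemma smooth_on_UNIV_if_closed_under_derivatives:
  assumes "\<And>f x. f \<in> S \<Longrightarrow> f differentiable (at x)"
    and "\<And>f v. f \<in> S \<Longrightarrow> (\<lambda>x. dff f x v) \<in> S" and "f \<in> S"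
  shows "smooth_on UNIV f"
  using Ck_on_UNIV_if_closed_under_derivatives[of S, OF assms] by (simp add: smooth_on_def)

lemma Ck_on_const: "Ck_on k U (\<lambda>_. c)"
  by (induction k arbitrary: c) auto

lemma smooth_on_const: "smooth_on U (\<lambda>_. c)"
  by (simp add: smooth_on_def Ck_on_const)

lemma smooth_on_id: "smooth_on U (\<lambda>x. x)"
proof -
  have "Ck_on k U (\<lambda>x. x)" for k
    by (cases k) (auto simp: Ck_on_const frechet_derivative_ident)
  then show ?thesis by (simp add: smooth_on_def)
qed

lemma smooth_on_imp_continuous_on: "smooth_on U f \<Longrightarrow> continuous_on U f"
  unfolding smooth_on_def by (metis Ck_on.simps(1))

section \<open>Length of curves\<close>

text \<open>Continuity of \<open>c\<close> carries the fundamental theorem of calculus across the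
  finitely many exceptional points.\<close>

lemma norm_diff_le_integral_of_speed_bound:
  fixes c :: "real \<Rightarrow> 'a::euclidean_space"
  assumes c: "c piecewise_C1_differentiable_on {0..1}"
    and L: "(g has_integral L) {0..1}"
    and le: "\<And>t. t \<in> {0..1} \<Longrightarrow> norm (vector_derivative c (at t)) \<le> g t"
  shows "norm (c 1 - c 0) \<le> L"
proof -
  obtain S where S: "finite S" "continuous_on {0..1} c" "c C1_differentiable_on ({0..1} - S)"
    using c by (auto simp: piecewise_C1_differentiable_on_def)
  have "((\<lambda>t. vector_derivative c (at t)) has_integral (c 1 - c 0)) {0..1}"
  proof (rule fundamental_theorem_of_calculus_interior_strong[OF S(1) _ _ S(2)])
    show "(c has_vector_derivative vector_derivative c (at x)) (at x)" if "x \<in> {0<..<1} - S" for x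
      using S(3) that by (auto simp: C1_differentiable_on_eq vector_derivative_works)
  qed simp
  then show ?thesis
    using integral_norm_bound_integral[of "\<lambda>t. vector_derivative c (at t)" "{0..1}" g] L le
    by (auto simp: has_integral_iff)
qed

section \<open>The cylinder over a horocycle\<close>

text \<open>A null vector representing the ideal point of the horocycle, which lies in the level set
  \<open>lor x horocycle_accel = -1\<close> and has this vector as constant second
  derivative.\<close>

definition horocycle_accel :: "real^4" where
  "horocycle_accel = axis 2 1 + axis 4 1"

definition horocycle_vel :: "real \<Rightarrow> real^4" where
  "horocycle_vel s = axis 1 1 + s *\<^sub>R horocycle_accel"

definition horocycle :: "real \<Rightarrow> real^4" where
  "horocycle s = axis 4 1 + s *\<^sub>R axis 1 1 + (s\<^sup>2 / 2) *\<^sub>R horocycle_accel"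

definition cyl :: "real^2 \<Rightarrow> real^4" where
  "cyl p = cosh (p$2) *\<^sub>R horocycle (p$1) + sinh (p$2) *\<^sub>R axis 3 1"

definition cyl_s :: "real^2 \<Rightarrow> real^4" where
  "cyl_s p = cosh (p$2) *\<^sub>R horocycle_vel (p$1)"

definition cyl_t :: "real^2 \<Rightarrow> real^4" where
  "cyl_t p = sinh (p$2) *\<^sub>R horocycle (p$1) + cosh (p$2) *\<^sub>R axis 3 1"

text \<open>The covariant acceleration of the unit speed horocycle in hyperbolic space; its length 1
  is the curvature. It does not depend on \<open>p$2\<close>, so it is constant along the
  rulings.\<close>

definition cyl_normal :: "real^2 \<Rightarrow> real^4" where
  "cyl_normal p = horocycle_accel - horocycle (p$1)"

lemma cosh_sq: "(cosh x)\<^sup>2 = 1 + (sinh x)\<^sup>2" for x :: real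
  by (simp add: cosh_square_eq)

lemma lor_horocycle_frame:
  "lor (horocycle s) (horocycle s) = -1" "lor (horocycle s) (horocycle_vel s) = 0"
  "lor (horocycle s) horocycle_accel = -1" "lor (horocycle s) (axis 3 1) = 0"
  "lor (horocycle_vel s) (horocycle_vel s) = 1" "lor (horocycle_vel s) horocycle_accel = 0"
  "lor (horocycle_vel s) (axis 3 1) = 0" "lor horocycle_accel horocycle_accel = 0"
  "lor horocycle_accel (axis 3 1) = 0" "lor (axis 3 1) (axis 3 1) = 1"
  "lor (horocycle_vel s) (horocycle s) = 0" "lor horocycle_accel (horocycle s) = -1"
  "lor (axis 3 1) (horocycle s) = 0" "lor horocycle_accel (horocycle_vel s) = 0"
  "lor (axis 3 1) (horocycle_vel s) = 0" "lor (axis 3 1) horocycle_accel = 0"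
  by (simp_all add: lor_def horocycle_def horocycle_vel_def horocycle_accel_def axis_def
      power2_eq_square algebra_simps)

lemma cyl_frame:
  "lor (cyl p) (cyl p) = -1" "lor (cyl_s p) (cyl p) = 0" "lor (cyl_t p) (cyl p) = 0"
  "lor (cyl_normal p) (cyl p) = 0" "lor (cyl_s p) (cyl_s p) = (cosh (p$2))\<^sup>2"
  "lor (cyl_s p) (cyl_t p) = 0" "lor (cyl_t p) (cyl_t p) = 1"
  "lor (cyl_normal p) (cyl_s p) = 0" "lor (cyl_normal p) (cyl_t p) = 0"
  "lor (cyl_normal p) (cyl_normal p) = 1"
  using cosh_sq[of "p$2"]
  by (simp_all add: cyl_def cyl_s_def cyl_t_def cyl_normal_def lor_algebra lor_horocycle_frame
      power2_eq_square)

lemma cyl_frame_swapped: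
  "lor (cyl p) (cyl_s p) = 0" "lor (cyl p) (cyl_t p) = 0" "lor (cyl p) (cyl_normal p) = 0"
  "lor (cyl_t p) (cyl_s p) = 0" "lor (cyl_s p) (cyl_normal p) = 0"
  "lor (cyl_t p) (cyl_normal p) = 0"
  using cyl_frame lor_commute by metis+

lemmas cyl_lor = lor_algebra cyl_frame cyl_frame_swapped

section \<open>Derivatives of the parametrization and its frame\<close>

lemma has_derivative_coordinate:
  "((\<lambda>p. p$i) has_derivative (\<lambda>v. v$i)) (at p)" for p :: "real^2"
  by (rule bounded_linear_imp_has_derivative[OF bounded_linear_vec_nth])

lemma has_derivative_cosh_sinh_coordinate:
  fixes p :: "real^2"
  shows "((\<lambda>p. cosh (p$i)) has_derivative (\<lambda>v. v$i * sinh (p$i))) (at p)"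
    "((\<lambda>p. sinh (p$i)) has_derivative (\<lambda>v. v$i * cosh (p$i))) (at p)"
  using DERIV_compose_FDERIV[OF has_field_derivative_cosh[OF DERIV_ident] has_derivative_coordinate]
    DERIV_compose_FDERIV[OF has_field_derivative_sinh[OF DERIV_ident] has_derivative_coordinate]
  by simp_all

lemma has_derivative_horocycle:
  fixes p :: "real^2"
  shows "((\<lambda>p. horocycle (p$i)) has_derivative (\<lambda>v. v$i *\<^sub>R horocycle_vel (p$i))) (at p)"
    "((\<lambda>p. horocycle_vel (p$i)) has_derivative (\<lambda>v. v$i *\<^sub>R horocycle_accel)) (at p)"
  unfolding horocycle_def horocycle_vel_def
  by (auto intro!: derivative_eq_intros has_derivative_coordinate simp: fun_eq_iff algebra_simps)

lemmas has_derivative_cyl_parts =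
  has_derivative_cosh_sinh_coordinate has_derivative_horocycle

lemma has_derivative_cyl:
  "(cyl has_derivative (\<lambda>v. v$1 *\<^sub>R cyl_s p + v$2 *\<^sub>R cyl_t p)) (at p)"
  unfolding cyl_def[abs_def] cyl_s_def cyl_t_def
  by (rule has_derivative_eq_rhs,
      (rule has_derivative_add has_derivative_scaleR has_derivative_cyl_parts has_derivative_const)+)
    (simp add: fun_eq_iff algebra_simps)

lemma dff_cyl: "dff cyl p = (\<lambda>v. v$1 *\<^sub>R cyl_s p + v$2 *\<^sub>R cyl_t p)"
  using frechet_derivative_at[OF has_derivative_cyl] by simp

lemma has_derivative_cyl_s:
  "(cyl_s has_derivative
     (\<lambda>v. v$1 *\<^sub>R (cosh (p$2) *\<^sub>R horocycle_accel) + v$2 *\<^sub>R (tanh (p$2) *\<^sub>R cyl_s p))) (at p)"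
  unfolding cyl_s_def[abs_def]
  by (rule has_derivative_eq_rhs,
      (rule has_derivative_add has_derivative_scaleR has_derivative_cyl_parts has_derivative_const)+)
    (simp add: fun_eq_iff tanh_def algebra_simps)

lemma has_derivative_cyl_t:
  "(cyl_t has_derivative (\<lambda>v. v$1 *\<^sub>R (tanh (p$2) *\<^sub>R cyl_s p) + v$2 *\<^sub>R cyl p)) (at p)"
  unfolding cyl_t_def[abs_def] cyl_s_def cyl_def
  by (rule has_derivative_eq_rhs,
      (rule has_derivative_add has_derivative_scaleR has_derivative_cyl_parts has_derivative_const)+)
    (simp add: fun_eq_iff tanh_def algebra_simps)

section \<open>Gauss formula, second fundamental forms and shape operator\<close>

text \<open>The pair \<open>cyl\<close>, \<open>cyl_t\<close> is a hyperbolic rotation of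
  \<open>horocycle\<close>, \<open>axis 3 1\<close> by \<open>p$2\<close>; inverting it expresses
  \<open>horocycle\<close> in the moving frame.\<close>

lemma cyl_ss:
  "cosh (p$2) *\<^sub>R horocycle_accel =
     cosh (p$2) *\<^sub>R cyl_normal p + (cosh (p$2))\<^sup>2 *\<^sub>R cyl p - (cosh (p$2) * sinh (p$2)) *\<^sub>R cyl_t p"
proof -
  have "cosh (p$2) *\<^sub>R cyl p - sinh (p$2) *\<^sub>R cyl_t p
      = ((cosh (p$2))\<^sup>2 - (sinh (p$2))\<^sup>2) *\<^sub>R horocycle (p$1)"
    by (simp add: cyl_def cyl_t_def algebra_simps power2_eq_square)
  then have "horocycle (p$1) = cosh (p$2) *\<^sub>R cyl p - sinh (p$2) *\<^sub>R cyl_t p"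
    by (simp add: cosh_sq)
  then have "cosh (p$2) *\<^sub>R (cyl_normal p + (cosh (p$2) *\<^sub>R cyl p - sinh (p$2) *\<^sub>R cyl_t p))
      = cosh (p$2) *\<^sub>R horocycle_accel"
    by (simp add: cyl_normal_def)
  then show ?thesis
    by (simp add: scaleR_add_right scaleR_diff_right power2_eq_square add_diff_eq)
qed

text \<open>The three summands are the second fundamental form in \<open>hyp3\<close>, the metric
  times the position vector (the normal of \<open>hyp3\<close> in Lorentz space), and the tangent
  part with the Christoffel symbols.\<close>

lemma ambient_deriv_cyl:
  "ambient_deriv cyl p x (\<lambda>_. y) =
     (x$1 * y$1 * cosh (p$2)) *\<^sub>R cyl_normal p
     + (x$1 * y$1 * (cosh (p$2))\<^sup>2 + x$2 * y$2) *\<^sub>R cyl p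
     + dff cyl p (vector [(x$1 * y$2 + x$2 * y$1) * tanh (p$2), - (x$1 * y$1 * cosh (p$2) * sinh (p$2))])"
proof -
  have "((\<lambda>q. dff cyl q y) has_derivative
      (\<lambda>v. y$1 *\<^sub>R (v$1 *\<^sub>R (cosh (p$2) *\<^sub>R horocycle_accel) + v$2 *\<^sub>R (tanh (p$2) *\<^sub>R cyl_s p))
         + y$2 *\<^sub>R (v$1 *\<^sub>R (tanh (p$2) *\<^sub>R cyl_s p) + v$2 *\<^sub>R cyl p))) (at p)"
    unfolding dff_cyl
    by (intro has_derivative_add has_derivative_scaleR_right has_derivative_cyl_s has_derivative_cyl_t)
  from frechet_derivative_at[OF this, symmetric] show ?thesis
    unfolding ambient_deriv_def cyl_ss
    by (simp add: dff_cyl algebra_simps)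
qed

lemma metric_cyl: "metric cyl p x y = (cosh (p$2))\<^sup>2 * x$1 * y$1 + x$2 * y$2"
  by (simp add: metric_def dff_cyl cyl_lor algebra_simps)

lemma inj_dff_cyl: "inj (dff cyl p)"
proof (rule injI)
  fix x y assume eq: "dff cyl p x = dff cyl p y"
  have "lor (dff cyl p x) (cyl_s p) = lor (dff cyl p y) (cyl_s p)"
    "lor (dff cyl p x) (cyl_t p) = lor (dff cyl p y) (cyl_t p)"
    by (simp_all add: eq)
  then show "x = y"
    by (simp add: dff_cyl cyl_lor vec_eq_iff forall_2)
qed

text \<open>\<open>cyl_normal p\<close> and \<open>cyl p\<close> are normal to the surface, and the
  induced metric is diagonal with nonzero entries, hence nondegenerate.\<close>

lemma lor_proj_tangent_cyl:
  assumes v: "v = a *\<^sub>R cyl_normal p + b *\<^sub>R cyl p + dff cyl p z"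
  shows "lor_proj (tangent cyl p) v = dff cyl p z"
proof (rule lor_proj_eqI)
  have "linear (dff cyl p)"
    unfolding dff_cyl by (rule has_derivative_linear[OF has_derivative_cyl])
  then show "subspace (tangent cyl p)"
    unfolding tangent_def by (rule linear_subspace_image) simp
  show "dff cyl p z \<in> tangent cyl p"
    by (simp add: tangent_def)
  show "lor (v - dff cyl p z) u = 0" if "u \<in> tangent cyl p" for u
    using that by (auto simp: v tangent_def dff_cyl cyl_lor)
  show "w = 0" if w: "w \<in> tangent cyl p" and orth: "\<And>u. u \<in> tangent cyl p \<Longrightarrow> lor w u = 0" for w
  proof -
    obtain y where y: "w = dff cyl p y" using w by (auto simp: tangent_def)
    have "metric cyl p y (axis 1 1) = 0" "metric cyl p y (axis 2 1) = 0"
      using orth by (auto simp: tangent_def metric_def y)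
    then show ?thesis
      by (simp add: metric_cyl axis_def y dff_cyl)
  qed
qed

text \<open>The entry with \<open>cosh\<close> and \<open>sinh\<close> makes the curves of constant
  \<open>p$2\<close> bend towards the geodesic \<open>p$2 = 0\<close>; it is what obstructs
  autoparallelism.\<close>

lemma levi_civita_cyl:
  "levi_civita cyl p x (\<lambda>_. y) =
     vector [(x$1 * y$2 + x$2 * y$1) * tanh (p$2), - (x$1 * y$1 * cosh (p$2) * sinh (p$2))]"
  unfolding levi_civita_def lor_proj_tangent_cyl[OF ambient_deriv_cyl]
  by (rule the_equality) (auto dest: injD[OF inj_dff_cyl])

lemma sff_L4_cyl:
  "sff_L4 cyl p x y = (x$1 * y$1 * cosh (p$2)) *\<^sub>R cyl_normal p
     + (x$1 * y$1 * (cosh (p$2))\<^sup>2 + x$2 * y$2) *\<^sub>R cyl p"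
  unfolding sff_L4_def Let_def lor_proj_tangent_cyl[OF ambient_deriv_cyl]
  by (simp add: ambient_deriv_cyl)

lemma sff_H3_cyl: "sff_H3 cyl p x y = (x$1 * y$1 * cosh (p$2)) *\<^sub>R cyl_normal p"
proof -
  define z :: "real^2" where
    "z = vector [(x$1 * y$2 + x$2 * y$1) * tanh (p$2), - (x$1 * y$1 * cosh (p$2) * sinh (p$2))]"
  \<comment> \<open>Projecting to \<open>hyp3\<close> removes the component along
    \<open>cyl p\<close>; the summand with coefficient 0 matches the form required by
    \<open>lor_proj_tangent_cyl\<close>.\<close>
  have "lor_proj (tangent_hyp3 (cyl p)) (ambient_deriv cyl p x (\<lambda>_. y)) =
      (x$1 * y$1 * cosh (p$2)) *\<^sub>R cyl_normal p + 0 *\<^sub>R cyl p + dff cyl p z" (is "?w = _")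
    by (simp add: lor_proj_tangent_hyp3 ambient_deriv_cyl dff_cyl cyl_lor z_def algebra_simps)
  moreover from this have "lor_proj (tangent cyl p) ?w = dff cyl p z"
    by (rule lor_proj_tangent_cyl)
  ultimately show ?thesis
    by (simp add: sff_H3_def Let_def)
qed

lemma cyl_normal_mem_normal_L4: "cyl_normal p \<in> normal_L4 cyl p"
  by (auto simp: normal_L4_def tangent_def dff_cyl cyl_lor)

text \<open>The principal curvatures \<open>1 / cosh (p$2)\<close> and 0 are distinct, so the
  coordinate lines are the only invariant lines.\<close>

lemma shape_cyl: "shape cyl p (cyl_normal p) x = vector [x$1 / cosh (p$2), 0]"
  unfolding shape_def
proof (rule the_equality)
  show "\<forall>y. metric cyl p (vector [x$1 / cosh (p$2), 0]) y = lor (sff_L4 cyl p x y) (cyl_normal p)"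
    by (simp add: metric_cyl sff_L4_cyl cyl_lor power2_eq_square)
  fix z assume z: "\<forall>y. metric cyl p z y = lor (sff_L4 cyl p x y) (cyl_normal p)"
  show "z = vector [x$1 / cosh (p$2), 0]"
    using z[rule_format, of "axis 1 1"] z[rule_format, of "axis 2 1"]
    by (simp add: metric_cyl sff_L4_cyl cyl_lor axis_def vec_eq_iff forall_2 power2_eq_square field_simps)
qed

section \<open>Nullity and its orthogonal complement\<close>

lemma nullity_cyl: "nullity cyl p = {x. x$1 = 0}"
proof -
  have "cyl_normal p \<noteq> 0" using cyl_frame(10)[of p] by (auto simp: lor_algebra)
  then show ?thesis
    by (auto simp: nullity_def sff_H3_cyl dest: spec[of _ "axis 1 1"])
qed

lemma span_singleton_line:
  fixes z :: "real^2"
  assumes "z$i = 0" "z$j \<noteq> 0"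
  shows "span {z} = {x. x$i = 0}"
proof -
  have ij: "i \<noteq> j" using assms by auto
  have "x = (x$j / z$j) *\<^sub>R z" if "x$i = 0" for x
    using ij that assms exhaust_2[of i] exhaust_2[of j] by (auto simp: vec_eq_iff forall_2)
  then show ?thesis
    using assms(1) by (auto simp: span_singleton)
qed

lemma line_1: "{x :: real^2. x$1 = 0} = span {axis 2 1}"
  by (rule span_singleton_line[symmetric, of _ _ 2]) (simp_all add: axis_def)

lemma line_2: "{x :: real^2. x$2 = 0} = span {axis 1 1}"
  by (rule span_singleton_line[symmetric, of _ _ 1]) (simp_all add: axis_def)

lemma dim_axis_lines: "dim {x :: real^2. x$1 = 0} = 1" "dim {x :: real^2. x$2 = 0} = 1"
  by (simp_all add: line_1 line_2 dim_span dim_singleton axis_eq_0_iff)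

lemma perp_cyl_line_1: "D p = {x. x$1 = 0} \<Longrightarrow> perp cyl D p = {x. x$2 = 0}"
  by (auto simp: perp_def metric_cyl axis_def dest: spec[of _ "axis 2 1"])

lemma nullity_perp_cyl: "nullity_perp cyl p = {x. x$2 = 0}"
  by (simp add: nullity_perp_def perp_cyl_line_1 nullity_cyl)

section \<open>Immersion, injectivity and image in hyperbolic space\<close>

lemma immersion_cyl: "immersion cyl"
proof -
  \<comment> \<open>Hyperbolic functions of \<open>p$2\<close> with vector-valued quadratic
    polynomials in \<open>p$1\<close> as coefficients: differentiating in \<open>p$2\<close> swaps
    \<open>cosh\<close> and \<open>sinh\<close>, in \<open>p$1\<close> it lowers the degree.\<close>
  define S :: "(real^2 \<Rightarrow> real^4) set" where
    "S = {\<lambda>p. cosh (p$2) *\<^sub>R (a + p$1 *\<^sub>R b + (p$1)\<^sup>2 *\<^sub>R c)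
            + sinh (p$2) *\<^sub>R (a' + p$1 *\<^sub>R b' + (p$1)\<^sup>2 *\<^sub>R c') | a b c a' b' c'. True}"
  have deriv: "((\<lambda>p. cosh (p$2) *\<^sub>R (a + p$1 *\<^sub>R b + (p$1)\<^sup>2 *\<^sub>R c)
            + sinh (p$2) *\<^sub>R (a' + p$1 *\<^sub>R b' + (p$1)\<^sup>2 *\<^sub>R c')) has_derivative
      (\<lambda>v. cosh (p$2) *\<^sub>R ((v$1 *\<^sub>R b + v$2 *\<^sub>R a') + p$1 *\<^sub>R ((2 * v$1) *\<^sub>R c + v$2 *\<^sub>R b') + (p$1)\<^sup>2 *\<^sub>R (v$2 *\<^sub>R c'))
         + sinh (p$2) *\<^sub>R ((v$1 *\<^sub>R b' + v$2 *\<^sub>R a) + p$1 *\<^sub>R ((2 * v$1) *\<^sub>R c' + v$2 *\<^sub>R b) + (p$1)\<^sup>2 *\<^sub>R (v$2 *\<^sub>R c))))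
      (at p)" for a b c a' b' c' :: "real^4" and p :: "real^2"
    by (rule has_derivative_eq_rhs,
        (rule has_derivative_add has_derivative_scaleR has_derivative_cosh_sinh_coordinate
          has_derivative_power has_derivative_coordinate has_derivative_const)+)
      (simp add: fun_eq_iff algebra_simps)
  have "smooth_on UNIV cyl"
  proof (rule smooth_on_UNIV_if_closed_under_derivatives[of S])
    show "f differentiable (at x)" if "f \<in> S" for f x
      using that deriv unfolding S_def differentiable_def by blast
    show "(\<lambda>x. dff f x v) \<in> S" if "f \<in> S" for f v
    proof -
      from that obtain a b c a' b' c' where f: "f = (\<lambda>p. cosh (p$2) *\<^sub>R (a + p$1 *\<^sub>R b + (p$1)\<^sup>2 *\<^sub>R c)
            + sinh (p$2) *\<^sub>R (a' + p$1 *\<^sub>R b' + (p$1)\<^sup>2 *\<^sub>R c'))"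
        unfolding S_def by blast
      show ?thesis
        unfolding S_def f frechet_derivative_at[OF deriv, symmetric] by blast
    qed
    have "cyl = (\<lambda>p. cosh (p$2) *\<^sub>R (axis 4 1 + p$1 *\<^sub>R axis 1 1 + (p$1)\<^sup>2 *\<^sub>R ((1/2) *\<^sub>R horocycle_accel))
            + sinh (p$2) *\<^sub>R (axis 3 1 + p$1 *\<^sub>R 0 + (p$1)\<^sup>2 *\<^sub>R 0))"
      by (simp add: fun_eq_iff cyl_def horocycle_def)
    then show "cyl \<in> S"
      unfolding S_def by blast
  qed
  then show ?thesis by (simp add: immersion_def inj_dff_cyl)
qed

text \<open>The third component is \<open>sinh (p$2)\<close> and the first is
  \<open>p$1 * cosh (p$2)\<close>.\<close>

lemma inj_cyl: "inj cyl"
proof (rule injI)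
  fix p q assume "cyl p = cyl q"
  then have "cyl p $ 3 = cyl q $ 3" "cyl p $ 1 = cyl q $ 1" by simp_all
  then show "p = q"
    by (simp add: cyl_def horocycle_def horocycle_accel_def axis_def vec_eq_iff forall_2)
qed

lemma range_cyl: "range cyl \<subseteq> hyp3"
  unfolding hyp3_def
proof (rule connected_component_maximal)
  have "cyl 0 = axis 4 1"
    by (simp add: cyl_def horocycle_def)
  then show "axis 4 1 \<in> range cyl" by (metis rangeI)
  show "connected (range cyl)"
    by (intro connected_continuous_image connected_UNIV smooth_on_imp_continuous_on)
      (use immersion_cyl in \<open>simp add: immersion_def\<close>)
  show "range cyl \<subseteq> {x. lor x x = - 1}"
    by (auto simp: cyl_frame)
qed

section \<open>Comparison with the Euclidean metric and completeness\<close>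

lemma metric_cyl_self: "metric cyl p v v = (cosh (p$2))\<^sup>2 * (v$1)\<^sup>2 + (v$2)\<^sup>2"
  by (simp add: metric_cyl power2_eq_square)

lemma norm_real2: "norm (v :: real^2) = sqrt ((v$1)\<^sup>2 + (v$2)\<^sup>2)"
  by (simp add: norm_vec_def L2_set_def UNIV_2)

lemma norm_le_speed_cyl: "norm v \<le> sqrt (metric cyl p v v)"
proof -
  have "1 * (v$1)\<^sup>2 \<le> (cosh (p$2))\<^sup>2 * (v$1)\<^sup>2"
    by (intro mult_right_mono) (simp_all add: cosh_sq)
  then show ?thesis by (simp add: norm_real2 metric_cyl_self)
qed

text \<open>Only a bound on a strip is possible, since \<open>cosh\<close> is unbounded.\<close>

lemma speed_cyl_le:
  assumes "\<bar>p$2\<bar> \<le> R"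
  shows "sqrt (metric cyl p v v) \<le> cosh R * norm v"
proof -
  have "cosh (p$2) \<le> cosh R"
    using assms cosh_real_nonneg_le_iff[of "\<bar>p$2\<bar>" R] by simp
  then have "(cosh (p$2))\<^sup>2 * (v$1)\<^sup>2 \<le> (cosh R)\<^sup>2 * (v$1)\<^sup>2"
    by (intro mult_right_mono power_mono) (simp_all add: cosh_real_nonneg)
  moreover have "1 * (v$2)\<^sup>2 \<le> (cosh R)\<^sup>2 * (v$2)\<^sup>2"
    by (intro mult_right_mono) (simp_all add: cosh_sq)
  ultimately have "metric cyl p v v \<le> (cosh R)\<^sup>2 * ((v$1)\<^sup>2 + (v$2)\<^sup>2)"
    by (simp add: metric_cyl_self algebra_simps)
  then show ?thesis
    using real_sqrt_le_mono by (fastforce simp: norm_real2 real_sqrt_mult)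
qed

text \<open>Every curve is at least as long as its Euclidean length, and the straight segment gives
  the upper bound.\<close>

lemma riem_dist_cyl_bounds:
  shows dist_le_riem_dist_cyl: "dist p q \<le> riem_dist cyl p q"
    and riem_dist_cyl_le: "\<bar>p$2\<bar> \<le> R \<Longrightarrow> \<bar>q$2\<bar> \<le> R \<Longrightarrow> riem_dist cyl p q \<le> cosh R * dist p q"
proof -
  define Ls where "Ls = {L. \<exists>c :: real \<Rightarrow> real^2.
     c piecewise_C1_differentiable_on {0..1} \<and> c 0 = p \<and> c 1 = q \<and>
     ((\<lambda>t. sqrt (metric cyl (c t) (vector_derivative c (at t)) (vector_derivative c (at t))))
        has_integral L) {0..1}}"
  have dist_eq: "riem_dist cyl p q = Inf Ls"
    by (simp add: riem_dist_def Ls_def)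
  have lower: "dist p q \<le> L" if "L \<in> Ls" for L
    using that norm_diff_le_integral_of_speed_bound[OF _ _ norm_le_speed_cyl]
    unfolding Ls_def by (fastforce simp: dist_norm norm_minus_commute)
  \<comment> \<open>The segment also shows that \<open>Ls\<close> is nonempty, without which
    \<open>Inf Ls\<close> would say nothing about lengths.\<close>
  define c where "c t = p + t *\<^sub>R (q - p)" for t
  have vd: "vector_derivative c (at t) = q - p" for t
    by (rule vector_derivative_at)
      (auto simp: c_def[abs_def] intro!: derivative_eq_intros)
  have c: "c piecewise_C1_differentiable_on {0..1}"
    by (rule C1_differentiable_imp_piecewise)
      (auto simp: C1_differentiable_on_def c_def[abs_def] intro!: exI[of _ "\<lambda>_. q - p"] derivative_eq_intros)
  define g where "g t = sqrt (metric cyl (c t) (q - p) (q - p))" for t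
  have "continuous_on {0..1} g"
    unfolding g_def metric_cyl c_def by (intro continuous_intros)
  then have int: "g integrable_on {0..1}"
    by (rule integrable_continuous_real)
  then have mem: "integral {0..1} g \<in> Ls"
    unfolding Ls_def using c
    by (intro CollectI exI[of _ c])
      (auto simp: vd has_integral_integral c_def simp flip: g_def[unfolded c_def])
  show "dist p q \<le> riem_dist cyl p q"
    unfolding dist_eq using mem lower by (intro cInf_greatest) auto
  assume R: "\<bar>p$2\<bar> \<le> R" "\<bar>q$2\<bar> \<le> R"
  have "g t \<le> cosh R * dist p q" if t: "t \<in> {0..1}" for t
  proof -
    \<comment> \<open>The strip is convex, so the segment stays in it.\<close>
    have "\<bar>c t $ 2\<bar> = \<bar>(1 - t) * p$2 + t * q$2\<bar>"
      by (simp add: c_def algebra_simps)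
    also have "\<dots> \<le> (1 - t) * \<bar>p$2\<bar> + t * \<bar>q$2\<bar>"
      using t abs_triangle_ineq[of "(1 - t) * p$2" "t * q$2"] by (simp add: abs_mult)
    also have "\<dots> \<le> R"
      using R t by (intro convex_bound_le) auto
    finally show ?thesis
      unfolding g_def by (metis speed_cyl_le dist_norm dist_commute)
  qed
  then have "integral {0..1} g \<le> integral {0..1} (\<lambda>t::real. cosh R * dist p q)"
    by (intro integral_le int) auto
  moreover have "riem_dist cyl p q \<le> integral {0..1} g"
    unfolding dist_eq using mem lower by (intro cInf_lower bdd_belowI) auto
  ultimately show "riem_dist cyl p q \<le> cosh R * dist p q" by simp
qed

text \<open>A Cauchy sequence is Euclidean Cauchy, so it has a Euclidean limit. Being bounded, it
  lies with its limit in one strip, where the upper bound turns Euclidean convergence back into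
  convergence for \<open>riem_dist\<close>.\<close>

lemma riem_complete_cyl: "riem_complete cyl"
  unfolding riem_complete_def
proof (intro allI impI)
  fix s :: "nat \<Rightarrow> real^2"
  assume "\<forall>e>0. \<exists>N. \<forall>m\<ge>N. \<forall>n\<ge>N. riem_dist cyl (s m) (s n) < e"
  then have "Cauchy s"
    unfolding Cauchy_def by (meson dist_le_riem_dist_cyl le_less_trans)
  then obtain l where l: "s \<longlonglongrightarrow> l"
    by (auto simp: Cauchy_convergent_iff convergent_def)
  obtain R where R: "\<And>n. norm (s n) \<le> R"
    using convergent_imp_Bseq[of s] l by (auto simp: convergent_def Bseq_def)
  have Rn: "\<bar>s n $ 2\<bar> \<le> R" for n
    using component_le_norm_cart[of "s n" 2] R[of n] by linarith
  have Rl: "\<bar>l $ 2\<bar> \<le> R"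
    by (rule LIMSEQ_le_const2[of "\<lambda>n. \<bar>s n $ 2\<bar>"]) (auto intro!: tendsto_intros l Rn)
  have "(\<lambda>n. cosh R * dist (s n) l) \<longlonglongrightarrow> cosh R * dist l l"
    by (intro tendsto_intros l)
  then have "(\<lambda>n. cosh R * dist (s n) l) \<longlonglongrightarrow> 0" by simp
  then have "(\<lambda>n. riem_dist cyl (s n) l) \<longlonglongrightarrow> 0"
    by (rule Lim_null_comparison[rotated])
      (use riem_dist_cyl_le[OF Rn Rl] in \<open>auto simp: abs_of_nonneg order_trans[OF zero_le_dist dist_le_riem_dist_cyl]\<close>)
  then show "\<exists>l. (\<lambda>n. riem_dist cyl (s n) l) \<longlonglongrightarrow> 0" by blast
qed

section \<open>Irreducibility\<close>

text \<open>The constant field \<open>axis 1 1\<close> lies in \<open>D\<close>, but its derivative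
  along itself has second component \<open>- cosh (p$2) * sinh (p$2)\<close>, nonzero at
  \<open>p\<close>.\<close>

lemma not_autoparallel_cyl:
  assumes U: "open U" "p \<in> U" "p$2 \<noteq> 0" and D: "\<And>q. q \<in> U \<Longrightarrow> D q = {x. x$2 = 0}"
  shows "\<not> autoparallel cyl D"
proof
  assume "autoparallel cyl D"
  then have "levi_civita cyl p (axis 1 1) (\<lambda>_. axis 1 1) \<in> D p"
    using U D unfolding autoparallel_def
    by (auto simp: smooth_on_const axis_def dest!: spec[of _ U] spec[of _ "\<lambda>_. axis 1 1"])
  then show False
    using U by (simp add: D levi_civita_cyl axis_def)
qed

lemma irreducible_cyl: "irreducible_submanifold cyl"
  unfolding irreducible_submanifold_def
proof safe
  fix k and D :: "real^2 \<Rightarrow> (real^2) set"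
  assume k: "0 < k" "k < DIM(real^2)" and D: "distribution k D" "shape_invariant cyl D"
    and auto: "autoparallel cyl D" "autoparallel cyl (perp cyl D)"
  have [simp]: "k = Suc 0" using k by simp
  \<comment> \<open>A point off the geodesic \<open>p$2 = 0\<close>, where neither candidate for
    \<open>D\<close> survives.\<close>
  define p :: "real^2" where "p = axis 2 1"
  have p: "p$2 \<noteq> 0" by (simp add: p_def axis_def)
  obtain U and X :: "nat \<Rightarrow> real^2 \<Rightarrow> real^2" where U: "open U" "p \<in> U"
    and X: "\<forall>i<k. smooth_on U (X i)" "\<forall>q\<in>U. D q = span ((\<lambda>i. X i q) ` {..<k}) \<and> dim (D q) = k"
    using D(1)[unfolded distribution_def, rule_format, of p] by blast
  define Z where "Z = X 0"
  have Dq: "D q = span {Z q}" and nz: "Z q \<noteq> 0" if "q \<in> U" for q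
    using X(2) that by (auto simp: Z_def lessThan_Suc)
  \<comment> \<open>Invariance makes \<open>Z q\<close> an eigenvector of a shape operator with two
    distinct eigenvalues.\<close>
  have alt: "Z q $ 1 = 0 \<or> Z q $ 2 = 0" if q: "q \<in> U" for q
  proof -
    have "Z q \<in> D q" by (simp add: Dq q span_base)
    then have "shape cyl q (cyl_normal q) (Z q) \<in> D q"
      using D(2) cyl_normal_mem_normal_L4 by (auto simp: shape_invariant_def)
    then obtain r where "vector [Z q $ 1 / cosh (q$2), 0] = r *\<^sub>R Z q"
      by (auto simp: Dq q shape_cyl span_singleton)
    then show ?thesis
      by (auto simp: vec_eq_iff forall_2)
  qed
  have cont: "continuous_on U (\<lambda>q. Z q $ i)" for i
    using smooth_on_imp_continuous_on X(1) by (auto simp: Z_def intro!: continuous_intros)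
  \<comment> \<open>By \<open>alt\<close>, \<open>V 1\<close> and \<open>V 2\<close> are disjoint
    open sets on which \<open>D\<close> is constant. Openness matters because autoparallelism is
    tested on fields over open sets.\<close>
  define V where "V i = {q \<in> U. Z q $ i \<noteq> 0}" for i
  have "open (V i)" for i
    using continuous_open_preimage[OF cont[of i] U(1), of "- {0}"]
    by (simp add: V_def vimage_def Int_def open_Compl)
  have D_V1: "D q = {x. x$2 = 0}" if "q \<in> V 1" for q
  proof -
    have "q \<in> U" "Z q $ 1 \<noteq> 0" "Z q $ 2 = 0" using that alt by (auto simp: V_def)
    then show ?thesis
      by (simp add: Dq span_singleton_line)
  qed
  have D_V2: "D q = {x. x$1 = 0}" if "q \<in> V 2" for q
  proof -
    have "q \<in> U" "Z q $ 2 \<noteq> 0" "Z q $ 1 = 0" using that alt by (auto simp: V_def)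
    then show ?thesis
      by (simp add: Dq span_singleton_line)
  qed
  \<comment> \<open>In the first case \<open>D\<close> itself fails to be autoparallel near
    \<open>p\<close>, in the second its orthogonal complement does.\<close>
  have "p \<in> V 1 \<or> p \<in> V 2"
    using nz[OF U(2)] U(2) by (auto simp: V_def vec_eq_iff forall_2)
  then show False
    using not_autoparallel_cyl[of "V 1" p D] not_autoparallel_cyl[of "V 2" p "perp cyl D"]
      \<open>\<And>i. open (V i)\<close> p D_V1 perp_cyl_line_1[of D, OF D_V2] auto by blast
qed

section \<open>Curves perpendicular to the nullity\<close>

text \<open>Along such a curve the second coordinate is continuous with zero derivative off a finite
  set, hence constant.\<close>

lemma not_perp_joinable_cyl:
  assumes "p$2 \<noteq> q$2"
  shows "\<not> perp_joinable cyl p q"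
proof
  assume "perp_joinable cyl p q"
  then obtain c where c: "c piecewise_differentiable_on {0..1}" "c 0 = p" "c 1 = q"
    and perp: "\<And>t v. t \<in> {0..1} \<Longrightarrow> (c has_vector_derivative v) (at t within {0..1}) \<Longrightarrow> v $ 2 = 0"
    unfolding perp_joinable_def nullity_perp_cyl by auto
  obtain S where S: "finite S" "continuous_on {0..1} c"
      "\<And>x. x \<in> {0..1} - S \<Longrightarrow> c differentiable (at x within {0..1})"
    using c(1) by (auto simp: piecewise_differentiable_on_def)
  have "((\<lambda>t. c t $ 2) has_derivative (\<lambda>h. 0)) (at x within {0..1})" if x: "x \<in> {0..1} - S" for x
  proof -
    obtain v where v: "(c has_vector_derivative v) (at x within {0..1})"
      using S(3)[OF x] vector_derivative_works by blast
    then have "v $ 2 = 0" using perp x by blast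
    then show ?thesis
      using bounded_linear.has_vector_derivative[OF bounded_linear_vec_nth[of 2] v]
      by (simp add: has_vector_derivative_def)
  qed
  then have "c 1 $ 2 = c 0 $ 2"
    using has_derivative_zero_unique_strong_interval[of S 0 1 "\<lambda>t. c t $ 2" "c 0 $ 2" 1] S(1,2)
    by (auto intro: continuous_intros)
  then show False using assms c by simp
qed

theorem mainTheorem3:
  shows "\<exists>f :: real^2 \<Rightarrow> real^4.
    immersion f \<and> inj f \<and> range f \<subseteq> hyp3 \<and>
    riem_complete f \<and> irreducible_submanifold f \<and>
    (\<forall>p. dim (nullity f p) = 1) \<and>
    distribution 1 (nullity_perp f) \<and> integrable_distribution (nullity_perp f) \<and>
    \<not> (\<forall>p q. perp_joinable f p q)"
proof (intro exI[of _ cyl] conjI)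
  \<comment> \<open>The perpendicular distribution is constant in the coordinates: a constant field
    is a global frame, and the identity is a foliation chart.\<close>
  show "distribution 1 (nullity_perp cyl)"
    unfolding distribution_def nullity_perp_cyl
    by (auto simp: lessThan_Suc smooth_on_const line_2 dim_singleton axis_eq_0_iff
        intro!: exI[of _ UNIV] exI[of _ "\<lambda>_ _. axis 1 1"])
  show "integrable_distribution (nullity_perp cyl)"
    unfolding integrable_distribution_def nullity_perp_cyl
    by (intro allI exI[of _ UNIV] exI[of _ "\<lambda>x. x"] exI[of _ "{x :: real^2. x$2 = 0}"])
      (auto simp: smooth_on_id frechet_derivative_ident bij_def inj_on_def subspace_def)
  show "\<not> (\<forall>p q. perp_joinable cyl p q)"
    using not_perp_joinable_cyl[of 0 "axis 2 1"] by (auto simp: axis_def)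
qed (simp_all add: immersion_cyl inj_cyl range_cyl riem_complete_cyl irreducible_cyl
    nullity_cyl dim_axis_lines)

end
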